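(* Let $G$ be a connected simple graph with at least two vertices. Then for every vertex $v_i$ of $G$, $$\mathcal{RE}_G(v_i)\leq\frac{1}{2}\left(\frac{1}{d_i}\sum_{j:\, v_j\sim v_i}\frac{1}{d_j}+1\right).$$
   Context: All graphs are finite and simple. For a graph $G$ with vertices $v_1,\dots,v_n$, let $d_i$ be the degree of $v_i$; $v_j\sim v_i$ means that $v_j$ and $v_i$ are adjacent. The Randić matrix $R(G)=(R_{ij})$ is the real symmetric $n\times n$ matrix with $R_{ij}=\frac{1}{\sqrt{d_id_j}}$ if $v_i\sim v_j$ and $R_{ij}=0$ otherwise. Put $|R(G)|=(R(G)R(G)^* )^{1/2}$ (positive semidefinite square root). The Randić energy of the vertex $v_i$ is $\mathcal{RE}_G(v_i)=|R(G)|_{ii}$, the $i$-th diagonal entry of $|R(G)|$. *)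

theory Defs
  imports "HOL-Analysis.Analysis" "Graph_Theory.Digraph_Component"
begin

text \<open>
  A finite simple graph is a \<^term>\<open>G\<close> with \<^prop>\<open>pair_graph G\<close>: finitely many vertices, no loops, and
  a symmetric arc set that contains \<open>(u, w)\<close> and \<open>(w, u)\<close> for every edge \<open>uw\<close>. The out-degree is
  therefore the degree. The vertices are listed by \<open>v\<close>, a bijection from a finite index
  type onto \<^term>\<open>pverts G\<close>; the index type plays the role of \<open>{1, ..., n}\<close>.
\<close>

definition degree_of :: "'a pair_pre_digraph \<Rightarrow> 'a \<Rightarrow> nat" where
  "degree_of G u = out_degree G u"

definition randic_matrix :: "'a pair_pre_digraph \<Rightarrow> ('n \<Rightarrow> 'a) \<Rightarrow> real^'n^'n" where
  "randic_matrix G v = (\<chi> i j.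
     if v i \<rightarrow>\<^bsub>G\<^esub> v j
     then 1 / sqrt (real (degree_of G (v i)) * real (degree_of G (v j)))
     else 0)"

definition psd :: "real^'n^'n \<Rightarrow> bool" where
  "psd A \<longleftrightarrow> transpose A = A \<and> (\<forall>x. 0 \<le> x \<bullet> (A *v x))"

definition psd_sqrt :: "real^'n^'n \<Rightarrow> real^'n^'n" where
  "psd_sqrt A = (THE B. psd B \<and> B ** B = A)"

text \<open>The matrices are real, so the adjoint is the transpose.\<close>

definition matrix_abs :: "real^'n^'n \<Rightarrow> real^'n^'n" where
  "matrix_abs A = psd_sqrt (A ** transpose A)"

definition randic_energy :: "'a pair_pre_digraph \<Rightarrow> ('n::finite \<Rightarrow> 'a) \<Rightarrow> 'n \<Rightarrow> real" where
  "randic_energy G v i = matrix_abs (randic_matrix G v) $ i $ i"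

end

theory Submission
  imports Defs
begin

text \<open>
  The bound is a case of \<open>2 |A|\<^sub>i\<^sub>i \<le> (A A\<^sup>T)\<^sub>i\<^sub>i + 1\<close>, for any real square matrix \<open>A\<close>. Write \<open>R\<close> for the Randic matrix and \<open>B = |R|\<close>. Since
  \<open>B\<close> is symmetric, the diagonal entry \<open>(B\<^sup>2)\<^sub>i\<^sub>i\<close> is the sum of the squares of the \<open>i\<close>-th row of
  \<open>B\<close>, so it is at least \<open>(B\<^sub>i\<^sub>i)\<^sup>2\<close>, and \<open>2 t \<le> t\<^sup>2 + 1\<close> gives
  \<open>2 B\<^sub>i\<^sub>i \<le> (B\<^sup>2)\<^sub>i\<^sub>i + 1\<close> (\<open>matrix_abs_diag_le\<close>). Now \<open>B\<^sup>2 = R R\<^sup>T\<close>, and the \<open>i\<close>-th diagonal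
  entry of \<open>R R\<^sup>T\<close> is the sum of \<open>1 / (d\<^sub>i d\<^sub>j)\<close> over the neighbours \<open>v\<^sub>j\<close> of \<open>v\<^sub>i\<close>
  (\<open>randic_gram_diag\<close>), which is the first term of the claim.

  The work lies in justifying that \<open>|A|\<close> is positive semidefinite with square \<open>A A\<^sup>T\<close>: as it is
  defined by a definite description, this needs existence and uniqueness of the positive
  semidefinite square root of \<open>A A\<^sup>T\<close>. Both are obtained without the spectral theorem.

  Uniqueness (\<open>psd_square_root_unique\<close>): if \<open>B\<^sup>2 = C\<^sup>2\<close> and \<open>D = B - C\<close>, then \<open>B D + D C = 0\<close>.
  Multiplying by \<open>D\<close> and taking traces shows that \<open>D B D\<close> and \<open>D C D\<close>, both positive
  semidefinite, have traces adding up to zero. This forces \<open>B D = C D = 0\<close>, so \<open>D\<^sup>2 = 0\<close> and \<open>D = 0\<close>.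

  Existence (\<open>polar_decomposition\<close>): the orthogonal group is compact, so some orthogonal \<open>U\<close>
  maximises \<open>trace (U S)\<close>. Comparing \<open>B = U S\<close> with \<open>Q B\<close>, where \<open>Q\<close> is one reflection or a product
  of two, shows that \<open>B\<close> is positive semidefinite and symmetric. Then
  \<open>B\<^sup>2 = B\<^sup>T B = S\<^sup>T U\<^sup>T U S = S\<^sup>T S\<close>, and \<open>S = A\<^sup>T\<close> gives the required root.
\<close>

section \<open>Uniqueness of positive semidefinite square roots\<close>

text \<open>
  The first-order condition at a minimum, for a quadratic polynomial that vanishes at its minimum
  point 0. It turns nonnegativity of quadratic expressions into linear identities.
\<close>

lemma linear_coeff_zero_if_quadratic_nonneg:
  fixes a b :: real
  assumes "\<And>e. 0 \<le> a * e + b * e\<^sup>2"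
  shows "a = 0"
proof (rule ccontr)
  assume "a \<noteq> 0"
  \<comment> \<open>At \<open>e = - a / c\<close> with \<open>c > b\<close> the linear term outweighs the quadratic one.\<close>
  define c where "c = \<bar>b\<bar> + 1"
  have c: "c > 0" "b \<le> c - 1" by (auto simp: c_def)
  have "a * (- a / c) + b * (- a / c)\<^sup>2 = (a / c)\<^sup>2 * (b - c)"
    using c(1) by (simp add: field_simps power2_eq_square)
  also have "\<dots> < 0"
    using c \<open>a \<noteq> 0\<close> by (intro mult_pos_neg) auto
  finally show False using assms[of "- a / c"] by linarith
qed

text \<open>
  The form \<open>y \<bullet> B y\<close> attains its minimum 0 at \<open>x\<close>, so its derivative there vanishes in every
  direction; the direction \<open>B x\<close> gives \<open>2 |B x|\<^sup>2 = 0\<close>.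
\<close>

lemma psd_mult_eq_0:
  fixes B :: "real^'n^'n"
  assumes "psd B" and "x \<bullet> (B *v x) = 0"
  shows "B *v x = 0"
proof -
  let ?y = "B *v x"
  have sym: "x \<bullet> (B *v ?y) = ?y \<bullet> ?y"
    using assms(1) dot_lmul_matrix[of x B ?y]
    by (simp add: psd_def flip: transpose_matrix_vector)
  have "2 * (?y \<bullet> ?y) = 0"
  proof (rule linear_coeff_zero_if_quadratic_nonneg)
    fix e :: real
    have "0 \<le> (x + e *\<^sub>R ?y) \<bullet> (B *v (x + e *\<^sub>R ?y))"
      using assms(1) by (simp add: psd_def)
    also have "\<dots> = 2 * (?y \<bullet> ?y) * e + (?y \<bullet> (B *v ?y)) * e\<^sup>2"
      using sym assms(2)
      by (simp add: matrix_vector_right_distrib matrix_vector_mult_scaleR inner_add_left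
          inner_add_right power2_eq_square algebra_simps)
    finally show "0 \<le> 2 * (?y \<bullet> ?y) * e + (?y \<bullet> (B *v ?y)) * e\<^sup>2" .
  qed
  then show ?thesis by simp
qed

lemma trace_conjugate:
  fixes B D :: "real^'n^'n"
  shows "trace (transpose D ** B ** D) = (\<Sum>k\<in>UNIV. column k D \<bullet> (B *v column k D))"
proof -
  have "trace (transpose D ** (B ** D)) = (\<Sum>k\<in>UNIV. column k D \<bullet> (B *v column k D))"
    by (simp add: trace_def column_def matrix_matrix_mult_def matrix_vector_mult_def
        inner_vec_def transpose_def)
  then show ?thesis by (simp add: matrix_mul_assoc)
qed

lemma gram_eq_0:
  fixes D :: "real^'n^'n"
  assumes "transpose D ** D = 0"
  shows "D = 0"
proof -
  have "(\<Sum>k\<in>UNIV. column k D \<bullet> column k D) = 0"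
    using trace_conjugate[of D "mat 1"] assms by (simp add: trace_def)
  then have "column k D = 0" for k
    by (simp add: sum_nonneg_eq_0_iff)
  then show ?thesis
    by (simp add: vec_eq_iff column_def)
qed

text \<open>
  The trace is a sum of the nonnegative values of the form at the columns of \<open>D\<close>, so each of
  these columns is annihilated by \<open>B\<close>.
\<close>

lemma psd_conjugate_zero:
  fixes B D :: "real^'n^'n"
  assumes "psd B" and "trace (transpose D ** B ** D) = 0"
  shows "B ** D = 0"
proof -
  have "column k D \<bullet> (B *v column k D) = 0" for k
    using assms by (simp add: trace_conjugate psd_def sum_nonneg_eq_0_iff)
  then have "B *v column k D = 0" for k
    using psd_mult_eq_0[OF assms(1)] by blast
  then show ?thesis
    by (simp add: vec_eq_iff column_def matrix_vector_mult_def matrix_matrix_mult_def)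
qed

lemma trace_conjugate_nonneg:
  fixes B D :: "real^'n^'n"
  assumes "psd B"
  shows "0 \<le> trace (transpose D ** B ** D)"
  using assms by (simp add: trace_conjugate psd_def sum_nonneg)

lemma matrix_diff_ldistrib:
  fixes A :: "'a::ring_1^'n^'m" and B C :: "'a^'k^'n"
  shows "A ** (B - C) = A ** B - A ** C"
  by (simp add: vec_eq_iff matrix_matrix_mult_def right_diff_distrib sum_subtractf)

lemma matrix_diff_rdistrib:
  fixes A B :: "'a::ring_1^'n^'m" and C :: "'a^'k^'n"
  shows "(A - B) ** C = A ** C - B ** C"
  by (simp add: vec_eq_iff matrix_matrix_mult_def left_diff_distrib sum_subtractf)

text \<open>
  Since \<open>B\<close> and \<open>C\<close> are not known to commute, \<open>B\<^sup>2 - C\<^sup>2\<close> is split as \<open>B D + D C\<close> with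
  \<open>D = B - C\<close>. After multiplication by \<open>D\<close> from the left, cyclicity of the trace makes both
  summands conjugates of positive semidefinite matrices by \<open>D\<close>.
\<close>

lemma psd_square_root_unique:
  fixes B C :: "real^'n^'n"
  assumes B: "psd B" and C: "psd C" and eq: "B ** B = C ** C"
  shows "B = C"
proof -
  define D where "D = B - C"
  have D: "transpose D = D"
    using B C by (simp add: D_def psd_def transpose_def vec_eq_iff)
  have "B ** D + D ** C = 0"
    using eq by (simp add: D_def matrix_diff_ldistrib matrix_diff_rdistrib)
  then have "D ** (B ** D + D ** C) = 0"
    by simp
  then have "trace (D ** B ** D) + trace (D ** (D ** C)) = 0"
    by (metis matrix_add_ldistrib matrix_mul_assoc trace_0 trace_add mat_0)
  moreover have "trace (D ** (D ** C)) = trace (D ** C ** D)"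
    using trace_mul_sym[of D "D ** C"] by simp
  ultimately have "trace (D ** B ** D) = 0" "trace (D ** C ** D) = 0"
    using trace_conjugate_nonneg[OF B, of D] trace_conjugate_nonneg[OF C, of D] D by auto
  then have "B ** D = 0" "C ** D = 0"
    using psd_conjugate_zero[OF B, of D] psd_conjugate_zero[OF C, of D] D by auto
  then have "transpose D ** D = 0"
    unfolding D by (simp add: D_def matrix_diff_rdistrib)
  then show ?thesis
    using gram_eq_0[of D] by (simp add: D_def)
qed

section \<open>Maximising the trace over the orthogonal group\<close>

text \<open>
  Dividing by \<open>u \<bullet> u\<close> makes this the reflection in the hyperplane orthogonal to \<open>u\<close> for every
  nonzero \<open>u\<close>, not only for unit vectors.
\<close>

definition householder :: "real^'n \<Rightarrow> real^'n^'n" where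
  "householder u = (\<chi> i j. (if i = j then 1 else 0) - 2 * u $ i * u $ j / (u \<bullet> u))"

lemma householder_mult_vec:
  fixes u x :: "real^'n"
  shows "householder u *v x = x - (2 * (u \<bullet> x) / (u \<bullet> u)) *\<^sub>R u"
proof -
  have "(householder u *v x) $ i = x $ i - (2 * (u \<bullet> x) / (u \<bullet> u)) * u $ i" for i
  proof -
    have "(householder u *v x) $ i =
        (\<Sum>j\<in>UNIV. (if i = j then x $ j else 0) - 2 * u $ i / (u \<bullet> u) * (u $ j * x $ j))"
      unfolding householder_def matrix_vector_mult_def vec_lambda_beta
      by (intro sum.cong) (auto simp: algebra_simps)
    also have "\<dots> = x $ i - 2 * u $ i / (u \<bullet> u) * (u \<bullet> x)"
      by (simp add: sum_subtractf inner_vec_def del: times_divide_eq_left flip: sum_distrib_left)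
    finally show ?thesis by (simp add: field_simps)
  qed
  then show ?thesis by (simp add: vec_eq_iff)
qed

lemma orthogonal_householder:
  fixes u :: "real^'n"
  assumes "u \<noteq> 0"
  shows "orthogonal_matrix (householder u)"
proof -
  have "u \<bullet> (householder u *v x) = - (u \<bullet> x)" for x
    using assms by (simp add: householder_mult_vec inner_diff_right)
  then have "householder u *v (householder u *v x) = x" for x
    unfolding householder_mult_vec[of u "householder u *v x"] by (simp add: householder_mult_vec)
  then have "householder u ** householder u = mat 1"
    by (simp add: matrix_eq matrix_vector_mul_assoc)
  moreover have "transpose (householder u) = householder u"
    by (simp add: householder_def transpose_def vec_eq_iff)
  ultimately show ?thesis
    by (simp add: orthogonal_matrix)
qed

lemma trace_householder:
  fixes u :: "real^'n" and B :: "real^'n^'n"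
  shows "trace (householder u ** B) = trace B - 2 * (u \<bullet> (B *v u)) / (u \<bullet> u)"
proof -
  have "trace (householder u ** B) =
      (\<Sum>i\<in>UNIV. (householder u *v column i B) $ i)"
    by (simp add: trace_def matrix_matrix_mult_def matrix_vector_mult_def column_def)
  also have "\<dots> = trace B - (\<Sum>i\<in>UNIV. 2 * (u \<bullet> column i B) / (u \<bullet> u) * u $ i)"
    by (simp add: householder_mult_vec sum_subtractf trace_def column_def)
  also have "(\<Sum>i\<in>UNIV. 2 * (u \<bullet> column i B) / (u \<bullet> u) * u $ i) =
      2 / (u \<bullet> u) * (\<Sum>i\<in>UNIV. (u \<bullet> column i B) * u $ i)"
    by (simp add: sum_distrib_left algebra_simps)
  also have "(\<Sum>i\<in>UNIV. (u \<bullet> column i B) * u $ i) = (u v* B) \<bullet> u"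
    by (simp add: inner_vec_def column_def vector_matrix_mult_def algebra_simps)
  finally show ?thesis
    by (simp add: dot_lmul_matrix)
qed

text \<open>
  A reflection along \<open>x\<close> changes the trace by \<open>-2 (x \<bullet> B x) / |x|\<^sup>2\<close>, so maximality makes the
  form of \<open>B\<close> nonnegative. Symmetry comes from products of two reflections, along a unit vector
  \<open>u\<close> and along \<open>w\<close>: they are rotations, the identity when \<open>w = u\<close>. Moving \<open>w\<close> away
  from \<open>u\<close> in a direction \<open>t\<close> orthogonal to \<open>u\<close> is an infinitesimal rotation in the plane of \<open>u\<close>
  and \<open>t\<close>, and the first-order change of the trace is proportional to
  \<open>t \<bullet> B u - u \<bullet> B t\<close>, which must vanish.
\<close>

lemma psd_if_trace_maximal:
  fixes B :: "real^'n^'n"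
  assumes max: "\<And>Q. orthogonal_matrix Q \<Longrightarrow> trace (Q ** B) \<le> trace B"
  shows "psd B"
proof -
  have nonneg: "0 \<le> x \<bullet> (B *v x)" for x
  proof (cases "x = 0")
    case False
    then have "0 < x \<bullet> x" by simp
    with max[OF orthogonal_householder[OF False]] show ?thesis
      by (simp add: trace_householder zero_le_divide_iff)
  qed simp
  \<comment> \<open>Maximality against the product of two reflections, cleared of the denominator \<open>w \<bullet> w\<close>.\<close>
  have two: "0 \<le> (u \<bullet> (B *v u)) * (w \<bullet> w) + w \<bullet> (B *v w) - 2 * (u \<bullet> w) * (u \<bullet> (B *v w))"
    if u: "u \<bullet> u = 1" for u w
  proof (cases "w = 0")
    case False
    then have w: "0 < w \<bullet> w" by simp
    have "u \<noteq> 0" using u by auto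
    then have "orthogonal_matrix (householder w ** householder u)"
      using False by (simp add: orthogonal_householder orthogonal_matrix_mul)
    from max[OF this]
    have "trace (householder w ** (householder u ** B)) \<le> trace B"
      by (simp add: matrix_mul_assoc)
    then have "0 \<le> u \<bullet> (B *v u) + (w \<bullet> (householder u *v (B *v w))) / (w \<bullet> w)"
      by (simp add: trace_householder u matrix_vector_mul_assoc)
    then have "0 \<le> (u \<bullet> (B *v u) + (w \<bullet> (householder u *v (B *v w))) / (w \<bullet> w)) * (w \<bullet> w)"
      using w by (intro mult_nonneg_nonneg) auto
    also have "\<dots> = (u \<bullet> (B *v u)) * (w \<bullet> w) + w \<bullet> (householder u *v (B *v w))"
      using False by (simp add: distrib_right)
    finally show ?thesis
      by (simp add: householder_mult_vec u inner_diff_right inner_commute algebra_simps)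
  qed simp
  have sym: "u \<bullet> (B *v t) = t \<bullet> (B *v u)" if u: "u \<bullet> u = 1" and ut: "u \<bullet> t = 0" for u t
  proof -
    have "t \<bullet> (B *v u) - u \<bullet> (B *v t) = 0"
    proof (rule linear_coeff_zero_if_quadratic_nonneg)
      fix e :: real
      \<comment> \<open>This is \<open>two\<close> at \<open>w = u + e t\<close>; the terms of order 0 in \<open>e\<close> cancel.\<close>
      have "t \<bullet> u = 0" using ut by (simp add: inner_commute)
      then show "0 \<le> (t \<bullet> (B *v u) - u \<bullet> (B *v t)) * e
          + ((u \<bullet> (B *v u)) * (t \<bullet> t) + t \<bullet> (B *v t)) * e\<^sup>2"
        using two[OF u, of "u + e *\<^sub>R t"] u ut
        by (simp add: matrix_vector_right_distrib matrix_vector_mult_scaleR inner_add_left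
            inner_add_right power2_eq_square algebra_simps)
    qed
    then show ?thesis by simp
  qed
  have "B $ i $ j = B $ j $ i" for i j
  proof (cases "i = j")
    case False
    then have "axis i 1 \<bullet> (B *v axis j 1) = axis j 1 \<bullet> (B *v axis i 1)"
      by (intro sym) (simp_all add: inner_axis_axis)
    then show ?thesis
      by (simp add: inner_axis' matrix_vector_mult_basis column_def)
  qed simp
  then show ?thesis
    using nonneg by (simp add: psd_def transpose_def vec_eq_iff)
qed

lemma compact_orthogonal_matrices: "compact {U :: real^'n^'n. orthogonal_matrix U}"
proof (rule compact_eq_bounded_closed[THEN iffD2], rule conjI)
  have "norm U \<le> sqrt (real CARD('n))" if "orthogonal_matrix U" for U :: "real^'n^'n"
  proof -
    \<comment> \<open>The norm here is the Frobenius norm, which is constant on the orthogonal group.\<close>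
    have "U \<bullet> U = trace (U ** transpose U)"
      by (simp add: inner_vec_def trace_def matrix_matrix_mult_def transpose_def)
    also have "\<dots> = real CARD('n)"
      using that by (simp add: orthogonal_matrix_def trace_I)
    finally show ?thesis by (simp add: norm_eq_sqrt_inner)
  qed
  then show "bounded {U :: real^'n^'n. orthogonal_matrix U}"
    unfolding bounded_iff by blast
  have "closed {U :: real^'n^'n. transpose U ** U = mat 1}"
    unfolding transpose_def matrix_matrix_mult_def
    by (intro closed_Collect_eq continuous_intros)
  then show "closed {U :: real^'n^'n. orthogonal_matrix U}"
    by (simp add: orthogonal_matrix)
qed

text \<open>
  A maximiser \<open>U\<close> of \<open>trace (U S)\<close> does at least as well as \<open>Q U\<close> for each orthogonal \<open>Q\<close>, which is the
  maximality of \<open>U S\<close> required by \<open>psd_if_trace_maximal\<close>.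
\<close>

lemma polar_decomposition:
  fixes S :: "real^'n^'n"
  obtains U where "orthogonal_matrix U" and "psd (U ** S)"
proof -
  have "continuous_on {U :: real^'n^'n. orthogonal_matrix U} (\<lambda>U. trace (U ** S))"
    unfolding trace_def matrix_matrix_mult_def by (simp, intro continuous_intros)
  moreover have "{U :: real^'n^'n. orthogonal_matrix U} \<noteq> {}"
    using orthogonal_matrix_id by blast
  ultimately obtain U where U: "orthogonal_matrix U"
      and max: "\<And>V. orthogonal_matrix V \<Longrightarrow> trace (V ** S) \<le> trace (U ** S)"
    using continuous_attains_sup[OF compact_orthogonal_matrices] by blast
  have "psd (U ** S)"
    using max U by (intro psd_if_trace_maximal) (simp add: matrix_mul_assoc orthogonal_matrix_mul)
  with U show ?thesis by (rule that)
qed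

section \<open>The absolute value of a matrix and its diagonal\<close>

text \<open>
  For the polar decomposition \<open>B = U A\<^sup>T\<close>, the symmetry of \<open>B\<close> lets \<open>B\<^sup>2\<close> be read as \<open>B\<^sup>T B\<close>, where
  \<open>U\<close> cancels.
\<close>

lemma matrix_abs_psd_square:
  fixes A :: "real^'n^'n"
  shows "psd (matrix_abs A)" and "matrix_abs A ** matrix_abs A = A ** transpose A"
proof -
  obtain U where U: "orthogonal_matrix U" and psd: "psd (U ** transpose A)"
    by (rule polar_decomposition)
  let ?B = "U ** transpose A"
  have "?B ** ?B = transpose ?B ** ?B"
    using psd by (simp add: psd_def)
  also have "\<dots> = A ** (transpose U ** U) ** transpose A"
    by (simp add: matrix_transpose_mul matrix_mul_assoc)
  also have "\<dots> = A ** transpose A"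
    using U by (simp add: orthogonal_matrix)
  finally have root: "psd ?B \<and> ?B ** ?B = A ** transpose A"
    using psd by simp
  have "\<exists>!B. psd B \<and> B ** B = A ** transpose A"
  proof (rule ex1I[of _ ?B])
    fix C assume "psd C \<and> C ** C = A ** transpose A"
    then have "psd C" and "C ** C = ?B ** ?B"
      using root by simp_all
    with root show "C = ?B"
      using psd_square_root_unique[of C ?B] by blast
  qed (fact root)
  from theI'[OF this]
  have "psd (matrix_abs A) \<and> matrix_abs A ** matrix_abs A = A ** transpose A"
    unfolding matrix_abs_def psd_sqrt_def .
  then show "psd (matrix_abs A)" and "matrix_abs A ** matrix_abs A = A ** transpose A"
    by blast+
qed

text \<open>
  The square of a diagonal entry is one term of the squared norm of its row, and the additive
  1 on the right comes from \<open>0 \<le> (t - 1)\<^sup>2\<close>.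
\<close>

lemma matrix_abs_diag_le:
  fixes A :: "real^'n^'n"
  shows "matrix_abs A $ i $ i \<le> 1 / 2 * ((A ** transpose A) $ i $ i + 1)"
proof -
  let ?B = "matrix_abs A"
  have "?B $ k $ i = ?B $ i $ k" for k
  proof -
    have "transpose ?B $ i $ k = ?B $ i $ k"
      using matrix_abs_psd_square(1)[of A] by (simp add: psd_def)
    then show ?thesis by (simp add: transpose_def)
  qed
  then have "(A ** transpose A) $ i $ i = (\<Sum>k\<in>UNIV. (?B $ i $ k)\<^sup>2)"
    unfolding matrix_abs_psd_square(2)[of A, symmetric]
    by (simp add: matrix_matrix_mult_def power2_eq_square)
  moreover have "(?B $ i $ i)\<^sup>2 \<le> (\<Sum>k\<in>UNIV. (?B $ i $ k)\<^sup>2)"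
    by (rule member_le_sum) auto
  moreover have "2 * ?B $ i $ i \<le> (?B $ i $ i)\<^sup>2 + 1"
    using sum_squares_bound[of "?B $ i $ i" 1] by simp
  ultimately show ?thesis by simp
qed

section \<open>The Randic energy of a vertex\<close>

lemma randic_gram_diag:
  fixes G :: "'a pair_pre_digraph" and v :: "'n::finite \<Rightarrow> 'a"
  assumes "pair_graph G"
  shows "(randic_matrix G v ** transpose (randic_matrix G v)) $ i $ i =
    1 / real (degree_of G (v i)) *
      (\<Sum>j | v j \<rightarrow>\<^bsub>G\<^esub> v i. 1 / real (degree_of G (v j)))"
proof -
  interpret pair_graph G by (rule assms)
  have sym: "(v j, v i) \<in> parcs G \<longleftrightarrow> (v i, v j) \<in> parcs G" for j
    using graph_symmetric by auto
  have "(randic_matrix G v ** transpose (randic_matrix G v)) $ i $ i =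
      (\<Sum>j\<in>UNIV. if v j \<rightarrow>\<^bsub>G\<^esub> v i
        then 1 / (real (degree_of G (v i)) * real (degree_of G (v j))) else 0)"
    by (auto simp: randic_matrix_def matrix_matrix_mult_def transpose_def sym
        intro!: sum.cong simp flip: real_sqrt_mult)
  also have "\<dots> = (\<Sum>j | v j \<rightarrow>\<^bsub>G\<^esub> v i.
      1 / (real (degree_of G (v i)) * real (degree_of G (v j))))"
    by (simp add: sum.inter_filter[symmetric])
  finally show ?thesis
    by (simp add: sum_distrib_left)
qed

theorem proposition3p1:
  fixes G :: "'a pair_pre_digraph" and v :: "'n::finite \<Rightarrow> 'a" and i :: 'n
  assumes "pair_graph G"
    and "Digraph_Component.connected G"
    and "card (pverts G) \<ge> 2"
    and "bij_betw v UNIV (pverts G)"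
  shows "randic_energy G v i \<le>
    1 / 2 * (1 / real (degree_of G (v i)) *
      (\<Sum>j | v j \<rightarrow>\<^bsub>G\<^esub> v i. 1 / real (degree_of G (v j))) + 1)"
  using matrix_abs_diag_le[of "randic_matrix G v" i]
  unfolding randic_energy_def randic_gram_diag[OF assms(1)] .

end
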